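(* Fix any $\gamma>0$ and consider the non-strongly convex quadratic optimization problem $\min_{x\in\mathbb{R}^d} f(x)$, $f(x)=\frac1n\sum_{i=1}^n f_i(x)$, where $f_i(x)=\frac12 x^\top A_i x-b_i^\top x$ for all $i\in\{1,\dots,n\}$, with $A_i\in\mathbb{R}^{d\times d}$ symmetric positive semidefinite and $b_i\in\mathbb{R}^d$. Assume that there exists $x_*\in\mathbb{R}^d$ such that $\nabla f_i(x_* )=0$ for all $i$ (interpolation). Then FedExProx with $\alpha=\frac{1}{\gamma L_\gamma}$ finds $\bar x$ such that $\mathbb{E}[f(\bar x)]-f(x_* )\le\varepsilon$ after $$\mathcal{O}\left(\frac{L_\gamma}{\mu_\gamma^+}\log\frac1\varepsilon\right)$$ iterations, where $L_\gamma$ is a smoothness constant of $M^\gamma$ and $\mu_\gamma^+$ is the smallest non-zero eigenvalue of the matrix $\nabla^2M^\gamma$.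
   Context: For a convex function $g$ and $\gamma>0$, $\mathrm{prox}_{\gamma g}(x)=\arg\min_z\{g(z)+\frac1{2\gamma}\|z-x\|^2\}$ and $M_g^\gamma(x)=\min_z\{g(z)+\frac1{2\gamma}\|z-x\|^2\}$ (Moreau envelope). $M^\gamma=\frac1n\sum_{i=1}^nM^\gamma_{f_i}$; here it is a quadratic with constant Hessian $\nabla^2M^\gamma=\frac1n\sum_{i=1}^n\frac1\gamma\big(I-(\gamma A_i+I)^{-1}\big)$. A smoothness constant of a function is a Lipschitz constant of its gradient; for $M^\gamma$ one takes $L_\gamma=\lambda_{\max}(\nabla^2M^\gamma)$. FedExProx with constant extrapolation parameter $\alpha$ iterates $x_{k+1}=x_k+\alpha\big(\frac1n\sum_{i=1}^n\mathrm{prox}_{\gamma f_i}(x_k)-x_k\big)$ from a starting point $x_0\in\mathbb{R}^d$. *)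

theory Defs
  imports "HOL-Analysis.Analysis"
begin

definition sym_psd :: "real^'d^'d \<Rightarrow> bool" where
  "sym_psd A \<longleftrightarrow> transpose A = A \<and> (\<forall>x. 0 \<le> x \<bullet> (A *v x))"

definition quad :: "real^'d^'d \<Rightarrow> real^'d \<Rightarrow> real^'d \<Rightarrow> real" where
  "quad A b x = 1/2 * (x \<bullet> (A *v x)) - b \<bullet> x"

definition avg :: "nat \<Rightarrow> (nat \<Rightarrow> 'v::real_vector) \<Rightarrow> 'v" where
  "avg n v = (1 / real n) *\<^sub>R (\<Sum>i = 1..n. v i)"

definition avg_quad :: "nat \<Rightarrow> (nat \<Rightarrow> real^'d^'d) \<Rightarrow> (nat \<Rightarrow> real^'d) \<Rightarrow> real^'d \<Rightarrow> real" where
  "avg_quad n A b x = avg n (\<lambda>i. quad (A i) (b i) x)"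

definition prox :: "real \<Rightarrow> ('v::real_normed_vector \<Rightarrow> real) \<Rightarrow> 'v \<Rightarrow> 'v" where
  "prox \<gamma> g x = (ARG_MIN (\<lambda>z. g z + 1 / (2 * \<gamma>) * (norm (z - x))\<^sup>2) z. True)"

definition moreau_env :: "real \<Rightarrow> ('v::real_normed_vector \<Rightarrow> real) \<Rightarrow> 'v \<Rightarrow> real" where
  "moreau_env \<gamma> g x = (INF z. g z + 1 / (2 * \<gamma>) * (norm (z - x))\<^sup>2)"

definition avg_moreau :: "real \<Rightarrow> nat \<Rightarrow> (nat \<Rightarrow> 'v::real_normed_vector \<Rightarrow> real) \<Rightarrow> 'v \<Rightarrow> real" where
  "avg_moreau \<gamma> n F x = avg n (\<lambda>i. moreau_env \<gamma> (F i) x)"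

(* The lemmas avg_moreau_quad_gradient and avg_moreau_quad_hessian below show that this
   matrix is the (constant) Hessian of avg_moreau \<gamma> n (\<lambda>i. quad (A i) (b i)). *)
definition moreau_hessian :: "real \<Rightarrow> nat \<Rightarrow> (nat \<Rightarrow> real^'d^'d) \<Rightarrow> real^'d^'d" where
  "moreau_hessian \<gamma> n A =
     avg n (\<lambda>i. (1 / \<gamma>) *\<^sub>R (mat 1 - matrix_inv (\<gamma> *\<^sub>R A i + mat 1)))"

definition eigenvalues :: "real^'d^'d \<Rightarrow> real set" where
  "eigenvalues H = {l. \<exists>v. v \<noteq> 0 \<and> H *v v = l *\<^sub>R v}"

definition lambda_max :: "real^'d^'d \<Rightarrow> real" where
  "lambda_max H = Max (eigenvalues H)"

(* Unspecified if H has no non-zero eigenvalue (for symmetric H: if H = 0). *)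
definition lambda_min_nonzero :: "real^'d^'d \<Rightarrow> real" where
  "lambda_min_nonzero H = Min (eigenvalues H - {0})"

(* By smoothness_const_L_moreau below, this is a smoothness constant of the averaged
   Moreau envelope. *)
definition L_moreau :: "real \<Rightarrow> nat \<Rightarrow> (nat \<Rightarrow> real^'d^'d) \<Rightarrow> real" where
  "L_moreau \<gamma> n A = lambda_max (moreau_hessian \<gamma> n A)"

definition mu_moreau :: "real \<Rightarrow> nat \<Rightarrow> (nat \<Rightarrow> real^'d^'d) \<Rightarrow> real" where
  "mu_moreau \<gamma> n A = lambda_min_nonzero (moreau_hessian \<gamma> n A)"

definition smoothness_const :: "real \<Rightarrow> ('v::real_inner \<Rightarrow> real) \<Rightarrow> bool" where
  "smoothness_const L g \<longleftrightarrow>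
     (\<exists>G. (\<forall>x. GDERIV g x :> G x) \<and> L-lipschitz_on UNIV G)"

primrec fedexprox ::
  "real \<Rightarrow> real \<Rightarrow> nat \<Rightarrow> (nat \<Rightarrow> 'v::real_normed_vector \<Rightarrow> real) \<Rightarrow> 'v \<Rightarrow> nat \<Rightarrow> 'v" where
  "fedexprox \<gamma> \<alpha> n F x0 0 = x0"
| "fedexprox \<gamma> \<alpha> n F x0 (Suc k) =
     (let x = fedexprox \<gamma> \<alpha> n F x0 k
      in x + \<alpha> *\<^sub>R (avg n (\<lambda>i. prox \<gamma> (F i) x) - x))"


lemma sym_inner: "transpose A = A \<Longrightarrow> x \<bullet> (A *v y) = (A *v x) \<bullet> (y::real^'d)"
  by (metis dot_lmul_matrix vector_transpose_matrix)

lemma shift_mv: "(\<gamma> *\<^sub>R A + mat 1) *v x = \<gamma> *\<^sub>R (A *v x) + (x::real^'d)"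
  by (simp add: matrix_vector_mult_add_rdistrib scaleR_matrix_vector_assoc)

lemma shift_invertible:
  fixes A :: "real^'d^'d"
  assumes "sym_psd A" "\<gamma> > 0"
  shows "invertible (\<gamma> *\<^sub>R A + mat 1)"
proof -
  have "v = 0" if "(\<gamma> *\<^sub>R A + mat 1) *v v = 0" for v
  proof -
    have "v \<bullet> (\<gamma> *\<^sub>R (A *v v) + v) = 0" using that by (simp add: shift_mv)
    hence "\<gamma> * (v \<bullet> (A *v v)) + v \<bullet> v = 0" by (simp add: inner_add_right)
    moreover have "\<gamma> * (v \<bullet> (A *v v)) \<ge> 0" using assms by (simp add: sym_psd_def)
    moreover have "v \<bullet> v \<ge> 0" by simp
    ultimately have "v \<bullet> v = 0" by linarith
    thus ?thesis by simp
  qed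
  thus ?thesis
    by (metis invertible_left_inverse matrix_left_invertible_ker)
qed

lemma shift_inverse:
  fixes A :: "real^'d^'d"
  assumes "sym_psd A" "\<gamma> > 0"
  defines "P \<equiv> matrix_inv (\<gamma> *\<^sub>R A + mat 1)"
  shows "\<gamma> *\<^sub>R (A *v (P *v x)) + P *v x = x" and "P *v (\<gamma> *\<^sub>R (A *v x) + x) = x"
proof -
  have i: "invertible (\<gamma> *\<^sub>R A + mat 1)" by (rule shift_invertible[OF assms(1,2)])
  have 1: "(\<gamma> *\<^sub>R A + mat 1) ** P = mat 1" "P ** (\<gamma> *\<^sub>R A + mat 1) = mat 1"
    using someI_ex[OF i[unfolded invertible_def]] by (auto simp: P_def matrix_inv_def)
  show "\<gamma> *\<^sub>R (A *v (P *v x)) + P *v x = x"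
    using 1(1) by (metis shift_mv matrix_vector_mul_assoc matrix_vector_mul_lid)
  show "P *v (\<gamma> *\<^sub>R (A *v x) + x) = x"
    using 1(2) by (metis shift_mv matrix_vector_mul_assoc matrix_vector_mul_lid)
qed

lemma shift_inverse_sym:
  fixes A :: "real^'d^'d"
  assumes "sym_psd A" "\<gamma> > 0"
  defines "P \<equiv> matrix_inv (\<gamma> *\<^sub>R A + mat 1)"
  shows "x \<bullet> (P *v y) = (P *v x) \<bullet> y"
proof -
  note s = shift_inverse(1)[OF assms(1,2), folded P_def]
  have t: "(P *v x) \<bullet> (A *v (P *v y)) = (A *v (P *v x)) \<bullet> (P *v y)"
    using assms(1) by (simp add: sym_psd_def sym_inner)
  have "x \<bullet> (P *v y) = (\<gamma> *\<^sub>R (A *v (P *v x)) + P *v x) \<bullet> (P *v y)" by (simp only: s)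
  also have "\<dots> = (P *v x) \<bullet> (\<gamma> *\<^sub>R (A *v (P *v y)) + P *v y)"
    by (simp add: inner_add_left inner_add_right t)
  finally show ?thesis by (simp only: s)
qed

lemma prox_objective_quad:
  fixes A :: "real^'d^'d" and b x :: "real^'d"
  assumes "sym_psd A" "\<gamma> > 0"
  defines "p \<equiv> matrix_inv (\<gamma> *\<^sub>R A + mat 1) *v (x + \<gamma> *\<^sub>R b)"
  shows "quad A b z + 1 / (2 * \<gamma>) * (norm (z - x))\<^sup>2 =
    (1 / (2 * \<gamma>)) * (x \<bullet> x - (x + \<gamma> *\<^sub>R b) \<bullet> p)
    + (1/2) * ((z - p) \<bullet> (A *v (z - p))) + (1 / (2 * \<gamma>)) * (norm (z - p))\<^sup>2"
proof -
  have p: "\<gamma> *\<^sub>R (A *v p) + p = x + \<gamma> *\<^sub>R b"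
    unfolding p_def by (rule shift_inverse(1)[OF assms(1,2)])
  have t: "p \<bullet> (A *v z) = (A *v p) \<bullet> z"
    using assms(1) by (simp add: sym_psd_def sym_inner)
  have e1: "\<gamma> * ((A *v p) \<bullet> z) + p \<bullet> z = x \<bullet> z + \<gamma> * (b \<bullet> z)"
    using arg_cong[OF p, of "\<lambda>w. w \<bullet> z"] by (simp add: inner_add_left)
  have e2: "\<gamma> * ((A *v p) \<bullet> p) + p \<bullet> p = (x + \<gamma> *\<^sub>R b) \<bullet> p"
    unfolding p[symmetric] by (simp add: inner_add_left)
  have "2 * \<gamma> * (quad A b z + 1 / (2 * \<gamma>) * (norm (z - x))\<^sup>2)
      = \<gamma> * (z \<bullet> (A *v z)) - 2 * \<gamma> * (b \<bullet> z) + (norm (z - x))\<^sup>2"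
    using assms(2) by (simp add: quad_def field_simps)
  also have "\<dots> = \<gamma> * (z \<bullet> (A *v z)) - 2 * (x \<bullet> z + \<gamma> * (b \<bullet> z)) + z \<bullet> z + x \<bullet> x"
    by (simp add: power2_norm_eq_inner inner_diff_left inner_diff_right inner_commute algebra_simps)
  also have "\<dots> = \<gamma> * (z \<bullet> (A *v z)) - 2 * (\<gamma> * ((A *v p) \<bullet> z) + p \<bullet> z) + z \<bullet> z + x \<bullet> x"
    by (simp only: e1)
  also have "\<dots> = x \<bullet> x - (x + \<gamma> *\<^sub>R b) \<bullet> p + \<gamma> * ((z - p) \<bullet> (A *v (z - p))) + (norm (z - p))\<^sup>2"
    unfolding e2[symmetric]
    by (simp add: power2_norm_eq_inner matrix_vector_mult_diff_distrib inner_diff_left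
        inner_diff_right t inner_commute algebra_simps)
  also have "\<dots> = 2 * \<gamma> * ((1 / (2 * \<gamma>)) * (x \<bullet> x - (x + \<gamma> *\<^sub>R b) \<bullet> p)
    + (1/2) * ((z - p) \<bullet> (A *v (z - p))) + (1 / (2 * \<gamma>)) * (norm (z - p))\<^sup>2)"
    using assms(2) by (simp add: distrib_left)
  finally show ?thesis using assms(2) by simp
qed

lemma prox_objective_quad_min:
  fixes A :: "real^'d^'d" and b x :: "real^'d"
  assumes "sym_psd A" "\<gamma> > 0"
  defines "p \<equiv> matrix_inv (\<gamma> *\<^sub>R A + mat 1) *v (x + \<gamma> *\<^sub>R b)"
  defines "\<Phi> \<equiv> \<lambda>z. quad A b z + 1 / (2 * \<gamma>) * (norm (z - x))\<^sup>2"
  shows "\<Phi> p = (1 / (2 * \<gamma>)) * (x \<bullet> x - (x + \<gamma> *\<^sub>R b) \<bullet> p)"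
    and "z \<noteq> p \<Longrightarrow> \<Phi> p < \<Phi> z"
proof -
  note o = prox_objective_quad[OF assms(1,2), of b _ x, folded p_def]
  show 1: "\<Phi> p = (1 / (2 * \<gamma>)) * (x \<bullet> x - (x + \<gamma> *\<^sub>R b) \<bullet> p)"
    unfolding \<Phi>_def o by simp
  assume "z \<noteq> p"
  hence "(1 / (2 * \<gamma>)) * (norm (z - p))\<^sup>2 > 0" using assms(2) by simp
  moreover have "(z - p) \<bullet> (A *v (z - p)) \<ge> 0" using assms(1) by (simp add: sym_psd_def)
  ultimately show "\<Phi> p < \<Phi> z" unfolding 1 unfolding \<Phi>_def o by linarith
qed

lemma prox_quad:
  fixes A :: "real^'d^'d"
  assumes "sym_psd A" "\<gamma> > 0"
  shows "prox \<gamma> (quad A b) x = matrix_inv (\<gamma> *\<^sub>R A + mat 1) *v (x + \<gamma> *\<^sub>R b)" (is "_ = ?p")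
proof -
  note m = prox_objective_quad_min(2)[OF assms, where x = x and b = b]
  show ?thesis
    unfolding prox_def
  proof (rule arg_minI[where x = ?p])
    show "\<not> quad A b y + 1 / (2 * \<gamma>) * (norm (y - x))\<^sup>2
          < quad A b ?p + 1 / (2 * \<gamma>) * (norm (?p - x))\<^sup>2" for y
      using m[of y] by (cases "y = ?p") auto
  next
    fix w assume "\<forall>y. True \<longrightarrow> \<not> quad A b y + 1 / (2 * \<gamma>) * (norm (y - x))\<^sup>2
          < quad A b w + 1 / (2 * \<gamma>) * (norm (w - x))\<^sup>2"
    thus "w = ?p" using m[of w] by blast
  qed simp
qed

lemma moreau_env_quad:
  fixes A :: "real^'d^'d"
  assumes "sym_psd A" "\<gamma> > 0"
  shows "moreau_env \<gamma> (quad A b) x = (1 / (2 * \<gamma>)) *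
    (x \<bullet> x - (x + \<gamma> *\<^sub>R b) \<bullet> (matrix_inv (\<gamma> *\<^sub>R A + mat 1) *v (x + \<gamma> *\<^sub>R b)))"
proof -
  let ?p = "matrix_inv (\<gamma> *\<^sub>R A + mat 1) *v (x + \<gamma> *\<^sub>R b)"
  note m1 = prox_objective_quad_min(1)[OF assms, where x = x and b = b]
  note m2 = prox_objective_quad_min(2)[OF assms, where x = x and b = b]
  have "moreau_env \<gamma> (quad A b) x = quad A b ?p + 1 / (2 * \<gamma>) * (norm (?p - x))\<^sup>2"
    unfolding moreau_env_def
  proof (rule cInf_eq_minimum)
    show "quad A b ?p + 1 / (2 * \<gamma>) * (norm (?p - x))\<^sup>2
       \<in> range (\<lambda>z. quad A b z + 1 / (2 * \<gamma>) * (norm (z - x))\<^sup>2)" by blast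
    fix v assume "v \<in> range (\<lambda>z. quad A b z + 1 / (2 * \<gamma>) * (norm (z - x))\<^sup>2)"
    then obtain z where v: "v = quad A b z + 1 / (2 * \<gamma>) * (norm (z - x))\<^sup>2" by blast
    show "quad A b ?p + 1 / (2 * \<gamma>) * (norm (?p - x))\<^sup>2 \<le> v"
      unfolding v using m2[of z] by (cases "z = ?p") auto
  qed
  thus ?thesis by (simp only: m1)
qed

lemma moreau_env_quad_gradient:
  fixes A :: "real^'d^'d"
  assumes "sym_psd A" "\<gamma> > 0"
  shows "GDERIV (moreau_env \<gamma> (quad A b)) x :> (1 / \<gamma>) *\<^sub>R (x - prox \<gamma> (quad A b) x)"
proof -
  define P where "P = matrix_inv (\<gamma> *\<^sub>R A + mat 1)"
  have s: "u \<bullet> (P *v v) = (P *v u) \<bullet> v" for u v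
    unfolding P_def by (rule shift_inverse_sym[OF assms])
  have [derivative_intros]: "(g has_derivative g') (at y) \<Longrightarrow>
      ((\<lambda>y. P *v g y) has_derivative (\<lambda>h. P *v g' h)) (at y)" for g g' y
    by (rule bounded_linear.has_derivative[OF matrix_vector_mul_bounded_linear])
  have "((\<lambda>x. (1 / (2 * \<gamma>)) * (x \<bullet> x - (x + \<gamma> *\<^sub>R b) \<bullet> (P *v (x + \<gamma> *\<^sub>R b)))) has_derivative
    (\<lambda>h. h \<bullet> ((1 / \<gamma>) *\<^sub>R (x - P *v (x + \<gamma> *\<^sub>R b))))) (at x)"
    apply (rule derivative_eq_intros refl)+
    apply (rule ext)
    subgoal for h
      using assms(2) s[of h "x + \<gamma> *\<^sub>R b"]
      by (simp add: inner_commute inner_diff_right inner_add_right field_simps)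
    done
  thus ?thesis
    unfolding gderiv_def prox_quad[OF assms] moreau_env_quad[OF assms, abs_def] P_def .
qed

lemma GDERIV_avg:
  assumes "\<And>i. i \<in> {1..n} \<Longrightarrow> GDERIV (F i) x :> G i"
  shows "GDERIV (\<lambda>x. avg n (\<lambda>i. F i x)) x :> avg n G"
proof -
  have "((\<lambda>x. (1 / real n) *\<^sub>R (\<Sum>i = 1..n. F i x)) has_derivative
     (\<lambda>h. (1 / real n) *\<^sub>R (\<Sum>i = 1..n. h \<bullet> G i))) (at x)"
    using assms unfolding gderiv_def
    by (intro has_derivative_scaleR_right has_derivative_sum) auto
  thus ?thesis by (simp add: gderiv_def avg_def inner_sum_right)
qed

lemma avg_moreau_quad_gradient:
  fixes A :: "nat \<Rightarrow> real^'d^'d"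
  assumes "\<gamma> > 0" "\<forall>i\<in>{1..n}. sym_psd (A i)"
  shows "GDERIV (avg_moreau \<gamma> n (\<lambda>i. quad (A i) (b i))) x :>
    avg n (\<lambda>i. (1 / \<gamma>) *\<^sub>R (x - prox \<gamma> (quad (A i) (b i)) x))"
  unfolding avg_moreau_def[abs_def]
  using assms by (intro GDERIV_avg moreau_env_quad_gradient) auto

lemma moreau_hessian_mv:
  "moreau_hessian \<gamma> n (A :: nat \<Rightarrow> real^'d^'d) *v h =
    avg n (\<lambda>i. (1 / \<gamma>) *\<^sub>R (h - matrix_inv (\<gamma> *\<^sub>R A i + mat 1) *v h))"
proof -
  have sum: "(\<Sum>i\<in>I. f i) *v h = (\<Sum>i\<in>I. f i *v h)" if "finite I"
    for f :: "nat \<Rightarrow> real^'d^'d" and I and h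
    using that by (induction I) (simp_all add: matrix_vector_mult_add_rdistrib)
  show ?thesis
    by (simp add: moreau_hessian_def avg_def sum matrix_vector_mult_diff_rdistrib
        flip: scaleR_matrix_vector_assoc)
qed

lemma avg_moreau_quad_gradient_diff:
  fixes A :: "nat \<Rightarrow> real^'d^'d"
  assumes "\<gamma> > 0" "\<forall>i\<in>{1..n}. sym_psd (A i)"
  shows "avg n (\<lambda>i. (1 / \<gamma>) *\<^sub>R (y - prox \<gamma> (quad (A i) (b i)) y))
       - avg n (\<lambda>i. (1 / \<gamma>) *\<^sub>R (x - prox \<gamma> (quad (A i) (b i)) x))
       = moreau_hessian \<gamma> n A *v (y - x)"
proof -
  have "(\<Sum>i = 1..n. (1 / \<gamma>) *\<^sub>R (y - prox \<gamma> (quad (A i) (b i)) y))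
       - (\<Sum>i = 1..n. (1 / \<gamma>) *\<^sub>R (x - prox \<gamma> (quad (A i) (b i)) x))
     = (\<Sum>i = 1..n. (1 / \<gamma>) *\<^sub>R (y - x - matrix_inv (\<gamma> *\<^sub>R A i + mat 1) *v (y - x)))"
    unfolding sum_subtractf[symmetric]
  proof (rule sum.cong[OF refl])
    fix i assume "i \<in> {1..n}"
    hence "sym_psd (A i)" using assms(2) by blast
    note p = prox_quad[OF this assms(1)]
    show "(1 / \<gamma>) *\<^sub>R (y - prox \<gamma> (quad (A i) (b i)) y)
       - (1 / \<gamma>) *\<^sub>R (x - prox \<gamma> (quad (A i) (b i)) x)
       = (1 / \<gamma>) *\<^sub>R (y - x - matrix_inv (\<gamma> *\<^sub>R A i + mat 1) *v (y - x))"
      unfolding p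
      by (simp add: matrix_vector_right_distrib matrix_vector_mult_diff_distrib algebra_simps)
  qed
  thus ?thesis
    unfolding moreau_hessian_mv avg_def scaleR_diff_right[symmetric] by simp
qed

lemma avg_moreau_quad_hessian:
  fixes A :: "nat \<Rightarrow> real^'d^'d"
  assumes "\<gamma> > 0" "\<forall>i\<in>{1..n}. sym_psd (A i)"
  shows "((\<lambda>x. avg n (\<lambda>i. (1 / \<gamma>) *\<^sub>R (x - prox \<gamma> (quad (A i) (b i)) x)))
    has_derivative (\<lambda>h. moreau_hessian \<gamma> n A *v h)) (at x)"
proof -
  define G where "G = (\<lambda>x. avg n (\<lambda>i. (1 / \<gamma>) *\<^sub>R (x - prox \<gamma> (quad (A i) (b i)) x)))"
  have "G y - G 0 = moreau_hessian \<gamma> n A *v (y - 0)" for y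
    unfolding G_def by (rule avg_moreau_quad_gradient_diff[OF assms])
  hence G: "G y = G 0 + moreau_hessian \<gamma> n A *v y" for y
    by (metis add.commute diff_add_cancel diff_zero)
  have "((\<lambda>y. G 0 + moreau_hessian \<gamma> n A *v y) has_derivative
      (\<lambda>h. 0 + moreau_hessian \<gamma> n A *v h)) (at x)"
    by (intro has_derivative_add has_derivative_const
        bounded_linear_imp_has_derivative matrix_vector_mul_bounded_linear)
  hence "(G has_derivative (\<lambda>h. moreau_hessian \<gamma> n A *v h)) (at x)"
    by (simp only: G[symmetric] add_0)
  thus ?thesis by (simp only: G_def)
qed

lemma sym_psd_moreau_hessian:
  fixes A :: "nat \<Rightarrow> real^'d^'d"
  assumes "\<gamma> > 0" "\<forall>i\<in>{1..n}. sym_psd (A i)"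
  shows "sym_psd (moreau_hessian \<gamma> n A)"
proof -
  let ?H = "moreau_hessian \<gamma> n A"
  let ?P = "\<lambda>i. matrix_inv (\<gamma> *\<^sub>R A i + mat 1)"
  have P: "x \<bullet> (?P i *v y) = (?P i *v x) \<bullet> y" if "i \<in> {1..n}" for i x y
    using that assms by (intro shift_inverse_sym) auto
  have "x \<bullet> (?H *v y) = (?H *v x) \<bullet> y" for x y
    unfolding moreau_hessian_mv avg_def inner_scaleR_right inner_scaleR_left
      inner_sum_right inner_sum_left inner_diff_right inner_diff_left
    by (intro arg_cong[where f = "\<lambda>t. 1 / real n * t"] sum.cong refl) (simp only: P)
  moreover have "x \<bullet> (?H *v y) = (transpose ?H *v x) \<bullet> y" for x y
    by (simp flip: dot_lmul_matrix)
  ultimately have "(transpose ?H *v x) \<bullet> y = (?H *v x) \<bullet> y" for x y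
    by simp
  hence "transpose ?H *v x = ?H *v x" for x
    using vector_eq_rdot by blast
  hence 1: "transpose ?H = ?H" by (simp add: matrix_eq)
  have "0 \<le> x \<bullet> (x - ?P i *v x)" if "i \<in> {1..n}" for i x
  proof -
    have A: "sym_psd (A i)" using that assms(2) by blast
    define y where "y = ?P i *v x"
    have x: "x = \<gamma> *\<^sub>R (A i *v y) + y"
      unfolding y_def by (rule shift_inverse(1)[OF A assms(1), symmetric])
    have "x \<bullet> (x - y) = \<gamma> * (\<gamma> * ((A i *v y) \<bullet> (A i *v y))) + \<gamma> * (y \<bullet> (A i *v y))"
      by (simp add: x inner_add_left distrib_left)
    also have "\<dots> \<ge> 0" using A assms(1) by (simp add: sym_psd_def)
    finally show ?thesis by (simp add: y_def)
  qed
  hence "0 \<le> x \<bullet> (?H *v x)" for x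
    unfolding moreau_hessian_mv avg_def inner_scaleR_right inner_sum_right
    using assms(1) by (intro mult_nonneg_nonneg sum_nonneg) auto
  with 1 show ?thesis by (simp add: sym_psd_def)
qed

lemma finite_eigenvalues_sym:
  fixes H :: "real^'d^'d"
  assumes "transpose H = H"
  shows "finite (eigenvalues H)"
proof -
  define w where "w l = (SOME v. v \<noteq> 0 \<and> H *v v = l *\<^sub>R v)" for l
  have w: "w l \<noteq> 0 \<and> H *v w l = l *\<^sub>R w l" if "l \<in> eigenvalues H" for l
    unfolding w_def using that someI_ex[of "\<lambda>v. v \<noteq> 0 \<and> H *v v = l *\<^sub>R v"]
    by (simp add: eigenvalues_def)
  have o: "w l \<bullet> w m = 0" if "l \<in> eigenvalues H" "m \<in> eigenvalues H" "l \<noteq> m" for l m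
  proof -
    have "w l \<bullet> (H *v w m) = (H *v w l) \<bullet> w m" by (rule sym_inner[OF assms])
    hence "m * (w l \<bullet> w m) = l * (w l \<bullet> w m)" using w that by simp
    thus ?thesis using that(3) by simp
  qed
  have "inj_on w (eigenvalues H)"
  proof (rule inj_onI, rule ccontr)
    fix l m assume "l \<in> eigenvalues H" "m \<in> eigenvalues H" "w l = w m" "l \<noteq> m"
    thus False using o[of l m] w[of m] by simp
  qed
  moreover have "finite (w ` eigenvalues H)"
  proof -
    have "pairwise orthogonal (w ` eigenvalues H)"
      using o by (auto simp: pairwise_def orthogonal_def)
    moreover have "0 \<notin> w ` eigenvalues H" using w by force
    ultimately have "independent (w ` eigenvalues H)"
      by (rule pairwise_orthogonal_independent)
    thus ?thesis by (rule independent_imp_finite)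
  qed
  ultimately show ?thesis by (rule finite_imageD[rotated])
qed

lemma norm_le_lambda_max:
  fixes H :: "real^'d^'d"
  assumes H: "sym_psd H"
  shows "norm (H *v x) \<le> lambda_max H * norm x" and "0 \<le> lambda_max H"
proof -
  have "continuous_on (sphere 0 1) (\<lambda>v. norm (H *v v))"
    by (intro continuous_intros linear_continuous_on matrix_vector_mul_bounded_linear)
  moreover have "compact (sphere (0::real^'d) 1)" "sphere (0::real^'d) 1 \<noteq> {}"
    by simp_all
  ultimately obtain v where v: "norm v = 1"
      and mx: "\<And>u. norm u = 1 \<Longrightarrow> norm (H *v u) \<le> norm (H *v v)"
    using continuous_attains_sup[of "sphere 0 1" "\<lambda>v. norm (H *v v)"] by auto
  define s where "s = norm (H *v v)"
  have s0: "s \<ge> 0" by (simp add: s_def)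
  have b: "norm (H *v u) \<le> s * norm u" for u
  proof (cases "u = 0")
    case False
    have "norm (H *v (u /\<^sub>R norm u)) \<le> s" unfolding s_def by (rule mx) (use False in simp)
    thus ?thesis using False
      by (simp add: matrix_vector_mult_scaleR field_simps)
  qed simp
  have sy: "u \<bullet> (H *v y) = (H *v u) \<bullet> y" for u y
    using H by (simp add: sym_psd_def sym_inner)
  have e: "H *v (H *v v) = s\<^sup>2 *\<^sub>R v"
  proof -
    have i: "(H *v (H *v v)) \<bullet> v = s\<^sup>2"
      by (simp add: s_def power2_norm_eq_inner flip: sy)
    have "norm (H *v (H *v v)) \<le> s * s" using b[of "H *v v"] by (simp add: s_def)
    hence n: "(norm (H *v (H *v v)))\<^sup>2 \<le> (s\<^sup>2)\<^sup>2"
      by (intro power_mono) (simp_all add: power2_eq_square)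
    have "(norm (H *v (H *v v) - s\<^sup>2 *\<^sub>R v))\<^sup>2
        = (norm (H *v (H *v v)))\<^sup>2 - 2 * s\<^sup>2 * ((H *v (H *v v)) \<bullet> v) + (s\<^sup>2)\<^sup>2 * (norm v)\<^sup>2"
      unfolding power2_norm_eq_inner
      by (simp add: inner_diff_left inner_diff_right inner_commute power2_eq_square
          algebra_simps)
    also have "\<dots> \<le> 0" using n v i by (simp add: power2_eq_square)
    finally show ?thesis by simp
  qed
  have "s \<in> eigenvalues H"
  proof (cases "s = 0")
    case True
    hence "H *v v = s *\<^sub>R v" by (simp add: s_def)
    moreover have "v \<noteq> 0" using v by auto
    ultimately show ?thesis by (auto simp: eigenvalues_def)
  next
    case False
    define u where "u = H *v v - s *\<^sub>R v"
    have "H *v u = - s *\<^sub>R u"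
      by (simp add: u_def matrix_vector_mult_diff_distrib matrix_vector_mult_scaleR e
          power2_eq_square algebra_simps)
    moreover have "0 \<le> u \<bullet> (H *v u)" using H by (simp add: sym_psd_def)
    ultimately have "s * (u \<bullet> u) \<le> 0" by simp
    hence "u \<bullet> u \<le> 0" using False s0 by (simp add: mult_le_0_iff)
    hence "u = 0" by (metis inner_ge_zero inner_eq_zero_iff order_antisym)
    hence "H *v v = s *\<^sub>R v" by (simp add: u_def)
    moreover have "v \<noteq> 0" using v by auto
    ultimately show ?thesis by (auto simp: eigenvalues_def)
  qed
  hence "s \<le> lambda_max H"
    unfolding lambda_max_def using H by (intro Max_ge finite_eigenvalues_sym) (auto simp: sym_psd_def)
  thus "norm (H *v x) \<le> lambda_max H * norm x" "0 \<le> lambda_max H"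
    using b[of x] s0 mult_right_mono[of s "lambda_max H" "norm x"] by auto
qed

lemma smoothness_const_L_moreau:
  fixes A :: "nat \<Rightarrow> real^'d^'d"
  assumes "\<gamma> > 0" "\<forall>i\<in>{1..n}. sym_psd (A i)"
  shows "smoothness_const (L_moreau \<gamma> n A) (avg_moreau \<gamma> n (\<lambda>i. quad (A i) (b i)))"
  unfolding smoothness_const_def
proof (intro exI conjI allI)
  show "GDERIV (avg_moreau \<gamma> n (\<lambda>i. quad (A i) (b i))) x :>
    avg n (\<lambda>i. (1 / \<gamma>) *\<^sub>R (x - prox \<gamma> (quad (A i) (b i)) x))" for x
    by (rule avg_moreau_quad_gradient[OF assms])
  show "(L_moreau \<gamma> n A)-lipschitz_on UNIV
      (\<lambda>x. avg n (\<lambda>i. (1 / \<gamma>) *\<^sub>R (x - prox \<gamma> (quad (A i) (b i)) x)))"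
    using norm_le_lambda_max[OF sym_psd_moreau_hessian[OF assms]]
    by (intro lipschitz_onI)
      (simp_all add: dist_norm L_moreau_def avg_moreau_quad_gradient_diff[OF assms])
qed

end

(* By interpolation the error e = x - xs evolves as e' = (I - H / L) e, where H is the Hessian of
   the averaged envelope and L its largest eigenvalue. The function V e = e . H e contracts by the
   factor 1 - mu / L in each step: this needs only |H e|^2 >= mu (e . H e), which holds because the
   minimum of the Rayleigh quotient over the range of H is a non-zero eigenvalue. The suboptimality
   of f is bounded by a constant multiple of V, so no projection onto the kernel of H is needed. *)
theory Submission
  imports Defs
begin

section \<open>Quadratics at a stationary point and their resolvents\<close>

lemma GDERIV_quad:
  fixes A :: "real^'d^'d"
  assumes "transpose A = A"
  shows "GDERIV (quad A b) x :> A *v x - b"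
proof -
  have [derivative_intros]: "(g has_derivative g') (at y) \<Longrightarrow>
      ((\<lambda>y. A *v g y) has_derivative (\<lambda>h. A *v g' h)) (at y)" for g g' y
    by (rule bounded_linear.has_derivative[OF matrix_vector_mul_bounded_linear])
  have "((\<lambda>x. 1/2 * (x \<bullet> (A *v x)) - b \<bullet> x) has_derivative (\<lambda>h. h \<bullet> (A *v x - b))) (at x)"
    apply (rule derivative_eq_intros refl)+
    apply (rule ext)
    subgoal for h
      using sym_inner[OF assms, of x h]
      by (simp add: inner_commute inner_diff_right field_simps)
    done
  thus ?thesis
    by (simp add: gderiv_def quad_def[abs_def])
qed

text \<open>Derivatives are unique, so testing both functionals against \<open>A *v xs - b\<close>
  forces that vector to vanish. This turns interpolation into linear equations.\<close>

lemma quad_stationary: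
  fixes A :: "real^'d^'d"
  assumes "transpose A = A" "GDERIV (quad A b) xs :> 0"
  shows "A *v xs = b"
proof -
  have "(\<lambda>h. h \<bullet> (A *v xs - b)) = (\<lambda>h. h \<bullet> 0)"
    using GDERIV_quad[OF assms(1), of b xs] assms(2) unfolding gderiv_def
    by (rule has_derivative_unique)
  hence "(A *v xs - b) \<bullet> (A *v xs - b) = 0" by (metis inner_zero_right)
  thus ?thesis by simp
qed

text \<open>The second-order expansion of a quadratic is exact, and its linear term vanishes at
  \<open>xs\<close>.\<close>

lemma quad_diff_stationary:
  fixes A :: "real^'d^'d"
  assumes "transpose A = A" "A *v xs = b"
  shows "quad A b x - quad A b xs = 1/2 * ((x - xs) \<bullet> (A *v (x - xs)))"
proof -
  have "xs \<bullet> (A *v x) = b \<bullet> x"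
    using sym_inner[OF assms(1), of xs x] assms(2) by simp
  thus ?thesis
    by (simp add: quad_def assms(2) matrix_vector_mult_diff_distrib inner_diff_left
        inner_diff_right inner_commute field_simps)
qed

text \<open>Since \<open>\<gamma> A xs + xs = xs + \<gamma> b\<close>, the resolvent maps the right
  side back to \<open>xs\<close>. Hence the gradient of the averaged envelope vanishes at a common
  stationary point.\<close>

lemma prox_quad_stationary:
  fixes A :: "real^'d^'d"
  assumes "sym_psd A" "\<gamma> > 0" "A *v xs = b"
  shows "prox \<gamma> (quad A b) xs = xs"
  using shift_inverse(2)[OF assms(1,2), of xs] by (simp add: prox_quad[OF assms(1,2)] assms(3) add.commute)

text \<open>With \<open>y = (\<gamma> A + I)\<^sup>-\<^sup>1 x\<close> both sides become combinations of \<open>|A y|\<^sup>2\<close> and \<open>y \<bullet> A y\<close>.\<close>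

lemma psd_form_le_resolvent_form:
  fixes A :: "real^'d^'d"
  assumes A: "sym_psd A" and g: "\<gamma> > 0"
  shows "x \<bullet> (A *v x) \<le>
    (lambda_max A + 2 / \<gamma>) * (x \<bullet> (x - matrix_inv (\<gamma> *\<^sub>R A + mat 1) *v x))"
proof -
  define y where "y = matrix_inv (\<gamma> *\<^sub>R A + mat 1) *v x"
  define u where "u = A *v y"
  \<comment> \<open>In \<open>C\<close>, the summand \<open>lambda_max A\<close> pays for
    \<open>u \<bullet> (A *v u)\<close> and \<open>2 / \<gamma>\<close> for the cross term
    \<open>2 * \<gamma> * (u \<bullet> u)\<close>; moreover \<open>C * \<gamma> \<ge> 1\<close>
    covers \<open>y \<bullet> u\<close>.\<close>
  define C where "C = lambda_max A + 2 / \<gamma>"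
  have x: "x = \<gamma> *\<^sub>R u + y"
    unfolding y_def u_def by (rule shift_inverse(1)[OF A g, symmetric])
  have C: "C * \<gamma> = \<gamma> * lambda_max A + 2"
    using g by (simp add: C_def distrib_left distrib_right)
  have l: "0 \<le> lambda_max A" by (rule norm_le_lambda_max(2)[OF A])
  have yu: "0 \<le> y \<bullet> u" using A by (simp add: u_def sym_psd_def)
  have sy: "y \<bullet> (A *v u) = u \<bullet> u"
    using A by (simp add: u_def sym_psd_def sym_inner)
  have "u \<bullet> (A *v u) \<le> norm u * norm (A *v u)" by (rule norm_cauchy_schwarz)
  also have "\<dots> \<le> norm u * (lambda_max A * norm u)"
    by (intro mult_left_mono norm_le_lambda_max(1)[OF A]) simp
  finally have uu: "u \<bullet> (A *v u) \<le> lambda_max A * (u \<bullet> u)"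
    by (simp add: dot_square_norm power2_eq_square mult_ac)
  have "A *v x = \<gamma> *\<^sub>R (A *v u) + u"
    by (simp add: x matrix_vector_right_distrib matrix_vector_mult_scaleR flip: u_def)
  hence "x \<bullet> (A *v x) = \<gamma>\<^sup>2 * (u \<bullet> (A *v u)) + 2 * \<gamma> * (u \<bullet> u) + y \<bullet> u"
    by (simp add: x inner_add_left inner_add_right sy power2_eq_square algebra_simps)
  also have "\<dots> \<le> \<gamma>\<^sup>2 * (lambda_max A * (u \<bullet> u)) + 2 * \<gamma> * (u \<bullet> u) + (C * \<gamma>) * (y \<bullet> u)"
    using uu yu l g C mult_right_mono[of 1 "C * \<gamma>" "y \<bullet> u"]
    by (intro add_mono mult_left_mono) auto
  also have "\<dots> = (C * \<gamma>) * (\<gamma> * (u \<bullet> u) + y \<bullet> u)"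
    by (simp add: C power2_eq_square algebra_simps)
  also have "\<dots> = C * (x \<bullet> (x - y))"
    by (simp add: x inner_add_left inner_commute algebra_simps)
  finally show ?thesis by (simp add: C_def y_def)
qed

section \<open>The smallest non-zero eigenvalue\<close>

text \<open>First variation: the residual \<open>g\<close> lies in the invariant subspace
  \<open>W\<close>, so \<open>v + t g\<close> is an admissible competitor. Its excess over the lower
  bound is \<open>2 t (g \<bullet> g) + t^2 Q\<close>, which some negative \<open>t\<close> makes
  negative unless \<open>g = 0\<close>.\<close>

lemma rayleigh_minimizer_eigenvector:
  fixes H :: "real^'d^'d"
  assumes H: "sym_psd H" and W: "subspace W" "\<And>w. w \<in> W \<Longrightarrow> H *v w \<in> W"
    and m: "\<And>w. w \<in> W \<Longrightarrow> m * (w \<bullet> w) \<le> w \<bullet> (H *v w)"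
    and v: "v \<in> W" "v \<bullet> (H *v v) = m * (v \<bullet> v)"
  shows "H *v v = m *\<^sub>R v"
proof -
  define g where "g = H *v v - m *\<^sub>R v"
  define Q where "Q = g \<bullet> (H *v g) - m * (g \<bullet> g)"
  \<comment> \<open>The optimal choice would divide by \<open>Q\<close>; the added 1 keeps the
    quotient meaningful when \<open>Q = 0\<close>.\<close>
  define t where "t = - (g \<bullet> g) / (Q + 1)"
  have gW: "g \<in> W" unfolding g_def using W v by (simp add: subspace_diff subspace_scale)
  have Q: "Q \<ge> 0" using m[OF gW] by (simp add: Q_def)
  have sy: "v \<bullet> (H *v g) = (H *v v) \<bullet> g" using H by (simp add: sym_psd_def sym_inner)
  have gg: "(H *v v) \<bullet> g = g \<bullet> g + m * (v \<bullet> g)"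
    by (simp add: g_def inner_diff_left)
  have "v + t *\<^sub>R g \<in> W" using W v gW by (simp add: subspace_add subspace_scale)
  from m[OF this] have "0 \<le> t\<^sup>2 * Q + 2 * t * (g \<bullet> g)"
    using v(2) sy gg
    by (simp add: Q_def matrix_vector_right_distrib matrix_vector_mult_scaleR inner_add_left
        inner_add_right inner_commute power2_eq_square algebra_simps)
  also have "t\<^sup>2 * Q + 2 * t * (g \<bullet> g) = - ((g \<bullet> g)\<^sup>2 * (Q + 2) / (Q + 1)\<^sup>2)"
    using Q by (simp add: t_def divide_simps) (simp add: power2_eq_square algebra_simps)
  finally have "(g \<bullet> g)\<^sup>2 * (Q + 2) / (Q + 1)\<^sup>2 \<le> 0" by simp
  hence "(g \<bullet> g)\<^sup>2 \<le> 0"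
    using Q by (simp add: divide_le_0_iff mult_le_0_iff)
  hence "g = 0" by simp
  thus ?thesis by (simp add: g_def)
qed

lemma eigenvalue_nonneg:
  fixes H :: "real^'d^'d"
  assumes "sym_psd H" "l \<in> eigenvalues H"
  shows "0 \<le> l"
proof -
  from assms(2) obtain v where v: "v \<noteq> 0" "H *v v = l *\<^sub>R v" by (auto simp: eigenvalues_def)
  have "0 \<le> v \<bullet> (H *v v)" using assms(1) by (simp add: sym_psd_def)
  hence "0 \<le> l * (v \<bullet> v)" using v by simp
  moreover have "0 < v \<bullet> v" using v by simp
  ultimately show ?thesis by (simp add: zero_le_mult_iff)
qed

text \<open>A minimizer of the Rayleigh quotient on the unit sphere of the range exists by
  compactness and is an eigenvector. Its eigenvalue \<open>m\<close> is non-zero and therefore at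
  least \<open>lambda_min_nonzero H\<close>.\<close>

lemma lambda_min_nonzero_range:
  fixes H :: "real^'d^'d"
  assumes H: "sym_psd H" and ne: "H *v a \<noteq> 0"
  shows "eigenvalues H - {0} \<noteq> {}"
    and "lambda_min_nonzero H * ((H *v y) \<bullet> (H *v y)) \<le> (H *v y) \<bullet> (H *v (H *v y))"
proof -
  define W where "W = range (\<lambda>x. H *v x)"
  have W: "subspace W"
    unfolding W_def by (intro linear_subspace_image subspace_UNIV) simp
  have HW: "H *v w \<in> W" for w unfolding W_def by blast
  have sy: "x \<bullet> (H *v z) = (H *v x) \<bullet> z" for x z
    using H by (simp add: sym_psd_def sym_inner)
  have "compact (sphere 0 1 \<inter> W)"
    using W by (intro compact_Int_closed closed_subspace) auto
  moreover have "(H *v a) /\<^sub>R norm (H *v a) \<in> sphere 0 1 \<inter> W"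
    using ne W HW by (simp add: subspace_scale)
  hence "sphere 0 1 \<inter> W \<noteq> {}" by blast
  moreover have "continuous_on (sphere 0 1 \<inter> W) (\<lambda>v. v \<bullet> (H *v v))"
    by (intro continuous_intros linear_continuous_on matrix_vector_mul_bounded_linear)
  ultimately obtain v where v: "norm v = 1" "v \<in> W"
      and mn: "\<And>u. norm u = 1 \<Longrightarrow> u \<in> W \<Longrightarrow> v \<bullet> (H *v v) \<le> u \<bullet> (H *v u)"
    using continuous_attains_inf[of "sphere 0 1 \<inter> W" "\<lambda>v. v \<bullet> (H *v v)"]
    by (metis IntE IntI mem_sphere_0)
  define m where "m = v \<bullet> (H *v v)"
  have b: "m * (w \<bullet> w) \<le> w \<bullet> (H *v w)" if "w \<in> W" for w
  proof (cases "w = 0")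
    case False
    have "m \<le> (w /\<^sub>R norm w) \<bullet> (H *v (w /\<^sub>R norm w))"
      unfolding m_def by (rule mn) (use False that W in \<open>simp_all add: subspace_scale\<close>)
    thus ?thesis using False
      by (simp add: matrix_vector_mult_scaleR dot_square_norm power2_eq_square field_simps)
  qed simp
  have e: "H *v v = m *\<^sub>R v"
    using rayleigh_minimizer_eigenvector[OF H W HW b v(2)] v(1)
    by (simp add: m_def dot_square_norm)
  have "v \<noteq> 0" using v(1) by auto
  with e have mE: "m \<in> eigenvalues H" by (auto simp: eigenvalues_def)
  have "m \<noteq> 0"
  proof
    assume "m = 0"
    hence Hv: "H *v v = 0" using e by simp
    \<comment> \<open>By symmetry the range is orthogonal to the kernel; \<open>v\<close> would lie
      in both.\<close>
    obtain z where z: "v = H *v z" using v(2) by (auto simp: W_def)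
    have "v \<bullet> v = (H *v v) \<bullet> z" by (subst (2) z) (simp add: sy)
    thus False using Hv \<open>v \<noteq> 0\<close> by simp
  qed
  with mE show "eigenvalues H - {0} \<noteq> {}" by blast
  have "lambda_min_nonzero H \<le> m"
    unfolding lambda_min_nonzero_def using H mE \<open>m \<noteq> 0\<close>
    by (intro Min_le) (auto simp: sym_psd_def finite_eigenvalues_sym)
  hence "lambda_min_nonzero H * ((H *v y) \<bullet> (H *v y)) \<le> m * ((H *v y) \<bullet> (H *v y))"
    by (intro mult_right_mono) auto
  also have "\<dots> \<le> (H *v y) \<bullet> (H *v (H *v y))" by (rule b[OF HW])
  finally show "lambda_min_nonzero H * ((H *v y) \<bullet> (H *v y)) \<le> (H *v y) \<bullet> (H *v (H *v y))" .
qed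

lemma lambda_min_nonzero_bounds:
  fixes H :: "real^'d^'d"
  assumes H: "sym_psd H" and ne: "H *v a \<noteq> 0"
  shows "0 < lambda_min_nonzero H" and "lambda_min_nonzero H \<le> lambda_max H"
proof -
  have f: "finite (eigenvalues H)" using H by (simp add: sym_psd_def finite_eigenvalues_sym)
  have "lambda_min_nonzero H \<in> eigenvalues H - {0}"
    unfolding lambda_min_nonzero_def
    using f lambda_min_nonzero_range(1)[OF assms] by (intro Min_in) auto
  thus "0 < lambda_min_nonzero H" "lambda_min_nonzero H \<le> lambda_max H"
    using eigenvalue_nonneg[OF H, of "lambda_min_nonzero H"] f
    by (auto simp: lambda_max_def less_le)
qed

text \<open>Only the component \<open>w\<close> of \<open>e\<close> in the range of \<open>H\<close>
  matters. There Cauchy-Schwarz gives \<open>\<mu> |w| \<le> |H w|\<close>, and a second application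
  bounds \<open>w \<bullet> (H *v w)\<close> by \<open>|w| |H w|\<close>.\<close>

lemma lambda_min_nonzero_le_norm:
  fixes H :: "real^'d^'d"
  assumes H: "sym_psd H" and ne: "H *v a \<noteq> 0"
  shows "lambda_min_nonzero H * (e \<bullet> (H *v e)) \<le> (H *v e) \<bullet> (H *v e)"
proof -
  define \<mu> where "\<mu> = lambda_min_nonzero H"
  have sy: "x \<bullet> (H *v z) = (H *v x) \<bullet> z" for x z
    using H by (simp add: sym_psd_def sym_inner)
  have W: "span (range (\<lambda>x. H *v x)) = range (\<lambda>x. H *v x)"
    by (intro span_eq_iff[THEN iffD2] linear_subspace_image subspace_UNIV) simp
  obtain w z where w: "w \<in> range (\<lambda>x. H *v x)"
    and z: "\<And>u. u \<in> range (\<lambda>x. H *v x) \<Longrightarrow> orthogonal z u" and e: "e = w + z"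
    using orthogonal_subspace_decomp_exists[of "range (\<lambda>x. H *v x)" e] unfolding W by metis
  \<comment> \<open>\<open>H (H z)\<close> lies in the range, to which \<open>z\<close> is
    orthogonal.\<close>
  have "(H *v z) \<bullet> (H *v z) = z \<bullet> (H *v (H *v z))" by (simp add: sy)
  also have "\<dots> = 0" using z by (simp add: orthogonal_def)
  finally have "H *v z = 0" by simp
  hence He: "H *v e = H *v w" and eHe: "e \<bullet> (H *v e) = w \<bullet> (H *v w)"
    using z by (simp_all add: e matrix_vector_right_distrib inner_add_left orthogonal_def)
  from w have "\<mu> * (w \<bullet> w) \<le> w \<bullet> (H *v w)"
    using lambda_min_nonzero_range(2)[OF assms] by (auto simp: \<mu>_def)
  also have "\<dots> \<le> norm w * norm (H *v w)" by (rule norm_cauchy_schwarz)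
  finally have "norm w * (\<mu> * norm w) \<le> norm w * norm (H *v w)"
    by (simp add: dot_square_norm power2_eq_square mult_ac)
  hence n: "\<mu> * norm w \<le> norm (H *v w)" by (cases "w = 0") auto
  have "\<mu> * (w \<bullet> (H *v w)) \<le> \<mu> * (norm w * norm (H *v w))"
    using lambda_min_nonzero_bounds(1)[OF assms]
    by (intro mult_left_mono norm_cauchy_schwarz) (simp add: \<mu>_def)
  also have "\<dots> \<le> norm (H *v w) * norm (H *v w)"
    using mult_right_mono[OF n, of "norm (H *v w)"] by (simp add: mult_ac)
  finally show ?thesis
    by (simp add: He eHe[unfolded He] \<mu>_def dot_square_norm power2_eq_square)
qed

section \<open>One step of the iteration\<close>

text \<open>With \<open>g = H e\<close>, expansion gives a decrease \<open>2 |g|^2 / L\<close> and a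
  second-order term of at most \<open>|g|^2 / L\<close>. The net decrease \<open>|g|^2 / L\<close>
  is at least \<open>\<mu> / L\<close> times the current form.\<close>

lemma gradient_step_contraction:
  fixes H :: "real^'d^'d" and e :: "real^'d"
  assumes H: "sym_psd H" and ne: "H *v a \<noteq> 0"
  defines "L \<equiv> lambda_max H" and "\<mu> \<equiv> lambda_min_nonzero H"
  defines "e' \<equiv> e - (1 / L) *\<^sub>R (H *v e)"
  shows "e' \<bullet> (H *v e') \<le> (1 - \<mu> / L) * (e \<bullet> (H *v e))"
proof -
  define g where "g = H *v e"
  have L: "L > 0" using lambda_min_nonzero_bounds[OF H ne] by (simp add: L_def)
  have sy: "e \<bullet> (H *v g) = g \<bullet> g"
    using H by (simp add: g_def sym_psd_def sym_inner)
  have "g \<bullet> (H *v g) \<le> norm g * norm (H *v g)" by (rule norm_cauchy_schwarz)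
  also have "\<dots> \<le> norm g * (L * norm g)"
    unfolding L_def by (intro mult_left_mono norm_le_lambda_max(1)[OF H]) simp
  finally have "g \<bullet> (H *v g) \<le> L * (g \<bullet> g)"
    by (simp add: dot_square_norm power2_eq_square mult_ac)
  hence "(1 / L\<^sup>2) * (g \<bullet> (H *v g)) \<le> (1 / L\<^sup>2) * (L * (g \<bullet> g))"
    by (intro mult_left_mono) auto
  hence 1: "(1 / L\<^sup>2) * (g \<bullet> (H *v g)) \<le> (1 / L) * (g \<bullet> g)"
    using L by (simp add: power2_eq_square)
  have 2: "(1 / L) * (\<mu> * (e \<bullet> g)) \<le> (1 / L) * (g \<bullet> g)"
    unfolding g_def \<mu>_def using L
    by (intro mult_left_mono lambda_min_nonzero_le_norm[OF H ne]) auto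
  have "e' \<bullet> (H *v e') = e \<bullet> g - 2 * ((1 / L) * (g \<bullet> g)) + (1 / L\<^sup>2) * (g \<bullet> (H *v g))"
    by (simp add: e'_def matrix_vector_mult_diff_distrib matrix_vector_mult_scaleR inner_diff_left
        inner_diff_right sy power2_eq_square diff_divide_distrib flip: g_def)
  also have "\<dots> \<le> e \<bullet> g - (1 / L) * (\<mu> * (e \<bullet> g))" using 1 2 by linarith
  also have "\<dots> = (1 - \<mu> / L) * (e \<bullet> g)" by (simp add: algebra_simps)
  finally show ?thesis by (simp add: g_def)
qed

text \<open>The method is gradient descent on the averaged envelope with step size
  \<open>\<alpha> * \<gamma>\<close>. The gradient is affine and vanishes at \<open>xs\<close>, so
  it equals the Hessian applied to the error.\<close>

lemma fedexprox_error:
  fixes A :: "nat \<Rightarrow> real^'d^'d" and \<alpha> :: real and x0 :: "real^'d"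
  assumes "\<gamma> > 0" "n \<ge> 1" "\<forall>i\<in>{1..n}. sym_psd (A i)" "\<forall>i\<in>{1..n}. A i *v xs = b i"
  defines "x \<equiv> fedexprox \<gamma> \<alpha> n (\<lambda>i. quad (A i) (b i)) x0"
  shows "x (Suc k) - xs = (x k - xs) - (\<alpha> * \<gamma>) *\<^sub>R (moreau_hessian \<gamma> n A *v (x k - xs))"
proof -
  let ?p = "\<lambda>i. prox \<gamma> (quad (A i) (b i))"
  have "avg n (\<lambda>i. (1 / \<gamma>) *\<^sub>R (xs - ?p i xs)) = 0"
    using assms(1,3,4) by (simp add: avg_def prox_quad_stationary)
  with avg_moreau_quad_gradient_diff[OF assms(1,3), of "x k" b xs]
  have H: "moreau_hessian \<gamma> n A *v (x k - xs) = avg n (\<lambda>i. (1 / \<gamma>) *\<^sub>R (x k - ?p i (x k)))"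
    by simp
  have "\<gamma> *\<^sub>R (moreau_hessian \<gamma> n A *v (x k - xs)) = x k - avg n (\<lambda>i. ?p i (x k))"
    unfolding H using assms(1,2)
    by (simp add: avg_def sum_subtractf sum_constant_scaleR scaleR_diff_right
        del: sum_constant flip: scaleR_sum_right)
  hence "(\<alpha> * \<gamma>) *\<^sub>R (moreau_hessian \<gamma> n A *v (x k - xs)) = \<alpha> *\<^sub>R (x k - avg n (\<lambda>i. ?p i (x k)))"
    by (simp flip: scaleR_scaleR)
  thus ?thesis by (simp add: x_def Let_def algebra_simps)
qed

section \<open>Suboptimality and the iteration count\<close>

text \<open>The resolvent bound is applied to each summand. The constant \<open>C\<close> is chosen
  before \<open>x\<close>, so it serves all iterates at once.\<close>

lemma avg_quad_le_moreau_form: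
  fixes A :: "nat \<Rightarrow> real^'d^'d"
  assumes "\<gamma> > 0" "\<forall>i\<in>{1..n}. sym_psd (A i)" "\<forall>i\<in>{1..n}. A i *v xs = b i"
  obtains C where "C \<ge> 0"
    and "\<And>x. avg_quad n A b x - avg_quad n A b xs
          \<le> C * ((x - xs) \<bullet> (moreau_hessian \<gamma> n A *v (x - xs)))"
proof
  \<comment> \<open>A sum of nonnegative terms serves as a common upper bound for all of
    them.\<close>
  define D where "D = (\<Sum>i = 1..n. lambda_max (A i) + 2 / \<gamma>)"
  have l: "0 \<le> lambda_max (A i) + 2 / \<gamma>" if "i \<in> {1..n}" for i
    using that assms(1,2) norm_le_lambda_max(2)[of "A i"] by simp
  have D: "lambda_max (A i) + 2 / \<gamma> \<le> D" if "i \<in> {1..n}" for i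
    unfolding D_def using that l by (intro member_le_sum) auto
  show "D * \<gamma> / 2 \<ge> 0" using l assms(1) unfolding D_def
    by (intro divide_nonneg_pos mult_nonneg_nonneg sum_nonneg) auto
  fix x
  define e where "e = x - xs"
  let ?R = "\<lambda>i. e \<bullet> (e - matrix_inv (\<gamma> *\<^sub>R A i + mat 1) *v e)"
  have R: "e \<bullet> (A i *v e) \<le> D * ?R i" if i: "i \<in> {1..n}" for i
  proof -
    have A: "sym_psd (A i)" using i assms(2) by blast
    have 1: "e \<bullet> (A i *v e) \<le> (lambda_max (A i) + 2 / \<gamma>) * ?R i"
      by (rule psd_form_le_resolvent_form[OF A assms(1)])
    \<comment> \<open>Enlarging the constant to \<open>D\<close> requires
      \<open>?R i \<ge> 0\<close>; this is read off from the bound itself, whose factor is positive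
      thanks to \<open>2 / \<gamma>\<close>.\<close>
    have "0 \<le> e \<bullet> (A i *v e)" using A by (simp add: sym_psd_def)
    with 1 have "0 \<le> (lambda_max (A i) + 2 / \<gamma>) * ?R i" by linarith
    moreover have "0 < lambda_max (A i) + 2 / \<gamma>"
      using norm_le_lambda_max(2)[OF A] assms(1) by (intro add_nonneg_pos) auto
    ultimately have "0 \<le> ?R i" by (simp add: zero_le_mult_iff)
    from mult_right_mono[OF D[OF i] this] 1 show ?thesis by linarith
  qed
  have "avg_quad n A b x - avg_quad n A b xs
      = (1 / real n) * (\<Sum>i = 1..n. quad (A i) (b i) x - quad (A i) (b i) xs)"
    by (simp add: avg_quad_def avg_def sum_subtractf diff_divide_distrib)
  also have "\<dots> = (1 / real n) * (\<Sum>i = 1..n. 1/2 * (e \<bullet> (A i *v e)))"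
    using assms(2,3) by (intro arg_cong2[where f = "(*)"] sum.cong refl)
      (simp add: e_def quad_diff_stationary sym_psd_def)
  also have "\<dots> \<le> (1 / real n) * (\<Sum>i = 1..n. 1/2 * (D * ?R i))"
    by (intro mult_left_mono sum_mono R) auto
  \<comment> \<open>The Hessian form is the average of \<open>?R i / \<gamma>\<close>, whence the
    factor \<open>\<gamma>\<close>.\<close>
  also have "\<dots> = D * \<gamma> / 2 * (e \<bullet> (moreau_hessian \<gamma> n A *v e))"
    using assms(1)
    by (simp add: moreau_hessian_mv avg_def inner_sum_right sum_distrib_left sum_divide_distrib
        mult.commute)
  finally show "avg_quad n A b x - avg_quad n A b xs
      \<le> D * \<gamma> / 2 * ((x - xs) \<bullet> (moreau_hessian \<gamma> n A *v (x - xs)))"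
    by (simp add: e_def)
qed

text \<open>The factor \<open>2\<close> in the iteration count leaves \<open>\<epsilon>\<^sup>2\<close> in place of \<open>\<epsilon>\<close>, which for small \<open>\<epsilon>\<close>
  absorbs both the initial error and the rounding.\<close>

lemma geometric_decay_iteration_count:
  fixes q D :: real and a :: "nat \<Rightarrow> real"
  assumes q: "0 < q" "q \<le> 1" and D: "0 \<le> D" and a: "\<And>k. a k \<le> D * (1 - q) ^ k"
  shows "\<forall>\<^sub>F \<epsilon> in at_right 0. \<exists>N. real N \<le> 2 * (1 / q) * ln (1 / \<epsilon>) \<and> (\<forall>k\<ge>N. a k \<le> \<epsilon>)"
proof -
  \<comment> \<open>The factor \<open>exp q\<close> is the price of rounding down, which can lose
    one iteration; the added 1 keeps \<open>1 / E\<close> meaningful.\<close>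
  define E where "E = D * exp q + 1"
  have E: "E > 0" using D by (simp add: E_def add_nonneg_pos)
  have "\<exists>N. real N \<le> 2 * (1 / q) * ln (1 / \<epsilon>) \<and> (\<forall>k\<ge>N. a k \<le> \<epsilon>)"
    if \<epsilon>: "0 < \<epsilon>" "\<epsilon> < min 1 (1 / E)" for \<epsilon>
  proof (intro exI[of _ "nat \<lfloor>2 * (1 / q) * ln (1 / \<epsilon>)\<rfloor>"] conjI allI impI)
    have p: "0 \<le> 2 * (1 / q) * ln (1 / \<epsilon>)" using q \<epsilon> by (intro mult_nonneg_nonneg ln_ge_zero) auto
    thus "real (nat \<lfloor>2 * (1 / q) * ln (1 / \<epsilon>)\<rfloor>) \<le> 2 * (1 / q) * ln (1 / \<epsilon>)" by simp
    fix k assume "nat \<lfloor>2 * (1 / q) * ln (1 / \<epsilon>)\<rfloor> \<le> k"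
    hence "2 * (1 / q) * ln (1 / \<epsilon>) \<le> real k + 1" using p by linarith
    hence "q * (2 * (1 / q) * ln (1 / \<epsilon>)) \<le> q * (real k + 1)"
      using q by (intro mult_left_mono) auto
    hence k: "- (real k * q) \<le> q + 2 * ln \<epsilon>"
      using q \<epsilon> by (simp add: ln_div algebra_simps)
    have "(1 - q) ^ k \<le> exp (- q) ^ k"
      using q exp_ge_add_one_self[of "- q"] by (intro power_mono) auto
    also have "\<dots> = exp (- (real k * q))" by (simp flip: exp_of_nat_mult)
    also have "\<dots> \<le> exp (q + 2 * ln \<epsilon>)" using k by simp
    also have "\<dots> = exp q * \<epsilon>\<^sup>2" using \<epsilon> by (simp add: exp_add exp_double)
    finally have "D * (1 - q) ^ k \<le> D * (exp q * \<epsilon>\<^sup>2)" using D by (rule mult_left_mono)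
    also have "\<dots> = (D * exp q * \<epsilon>) * \<epsilon>" by (simp add: power2_eq_square)
    also have "\<dots> \<le> (E * \<epsilon>) * \<epsilon>" using \<epsilon> by (intro mult_right_mono) (auto simp: E_def)
    also have "\<dots> \<le> 1 * \<epsilon>" using \<epsilon> E by (intro mult_right_mono) (auto simp: field_simps)
    finally show "a k \<le> \<epsilon>" using a[of k] by simp
  qed
  thus ?thesis
    using E by (auto simp: eventually_at_right_field intro!: exI[of _ "min 1 (1 / E)"])
qed

text \<open>The method is deterministic, so no expectation appears. The order bound has the absolute
  constant 2 for all sufficiently small \<open>\<epsilon>\<close>, where the threshold may depend on
  the data.\<close>

theorem theorem4p1:
  fixes \<gamma> :: real and n :: nat
    and A :: "nat \<Rightarrow> real^'d^'d" and b :: "nat \<Rightarrow> real^'d" and x0 xs :: "real^'d"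
  assumes "\<gamma> > 0" and "n \<ge> 1"
    and "\<forall>i\<in>{1..n}. sym_psd (A i)"
    and "\<forall>i\<in>{1..n}. GDERIV (quad (A i) (b i)) xs :> 0"
  shows "\<forall>\<^sub>F \<epsilon> in at_right 0.
    \<exists>N. real N \<le> 2 * (L_moreau \<gamma> n A / mu_moreau \<gamma> n A) * ln (1 / \<epsilon>) \<and>
      (\<forall>k\<ge>N.
        avg_quad n A b
            (fedexprox \<gamma> (1 / (\<gamma> * L_moreau \<gamma> n A)) n (\<lambda>i. quad (A i) (b i)) x0 k)
          - avg_quad n A b xs \<le> \<epsilon>)"
proof -
  define H where "H = moreau_hessian \<gamma> n A"
  define L where "L = L_moreau \<gamma> n A"
  define \<mu> where "\<mu> = mu_moreau \<gamma> n A"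
  define x where "x = fedexprox \<gamma> (1 / (\<gamma> * L)) n (\<lambda>i. quad (A i) (b i)) x0"
  define V where "V k = (x k - xs) \<bullet> (H *v (x k - xs))" for k
  have st: "\<forall>i\<in>{1..n}. A i *v xs = b i"
    using assms(3,4) by (auto simp: sym_psd_def intro: quad_stationary)
  have H: "sym_psd H" unfolding H_def by (rule sym_psd_moreau_hessian[OF assms(1,3)])
  obtain C where C: "C \<ge> 0" "\<And>k. avg_quad n A b (x k) - avg_quad n A b xs \<le> C * V k"
    using avg_quad_le_moreau_form[OF assms(1,3) st] unfolding V_def H_def by metis
  have "\<forall>\<^sub>F \<epsilon> in at_right 0. \<exists>N. real N \<le> 2 * (L / \<mu>) * ln (1 / \<epsilon>) \<and>
      (\<forall>k\<ge>N. avg_quad n A b (x k) - avg_quad n A b xs \<le> \<epsilon>)"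
  proof (cases "\<exists>a. H *v a \<noteq> 0")
    \<comment> \<open>Here \<open>\<mu>\<close> is unspecified, but \<open>L = 0\<close> makes the
      iteration bound 0 for any \<open>\<mu>\<close>. Since \<open>V\<close> vanishes,
      \<open>N = 0\<close> works.\<close>
    case False
    have "L \<in> eigenvalues H"
      unfolding L_def L_moreau_def lambda_max_def H_def[symmetric]
    proof (rule Max_in)
      show "finite (eigenvalues H)" using H by (simp add: sym_psd_def finite_eigenvalues_sym)
      have "(1 :: real^'d) \<noteq> 0" by simp
      hence "0 \<in> eigenvalues H" unfolding eigenvalues_def using False
        by (intro CollectI exI[of _ 1]) simp
      thus "eigenvalues H \<noteq> {}" by blast
    qed
    hence "L = 0" using False by (auto simp: eigenvalues_def)
    moreover have "avg_quad n A b (x k) - avg_quad n A b xs \<le> \<epsilon>" if "0 < \<epsilon>" for k \<epsilon>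
      using C(2)[of k] False that by (simp add: V_def)
    ultimately show ?thesis
      by (intro eventually_at_right_less[THEN eventually_mono] exI[of _ 0]) auto
  next
    case True
    then obtain a where a: "H *v a \<noteq> 0" by blast
    have L: "L = lambda_max H" and \<mu>: "\<mu> = lambda_min_nonzero H"
      by (simp_all add: L_def \<mu>_def L_moreau_def mu_moreau_def H_def)
    have pos: "0 < \<mu>" "\<mu> \<le> L"
      unfolding L \<mu> by (rule lambda_min_nonzero_bounds[OF H a])+
    have "V (Suc k) \<le> (1 - \<mu> / L) * V k" for k
    proof -
      \<comment> \<open>The extrapolation parameter makes the effective step size
        \<open>1 / L\<close>.\<close>
      have "1 / (\<gamma> * L) * \<gamma> = 1 / L" using assms(1) by simp
      hence "x (Suc k) - xs = (x k - xs) - (1 / L) *\<^sub>R (H *v (x k - xs))"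
        using fedexprox_error[OF assms(1-3) st, of "1 / (\<gamma> * L)" x0 k]
        by (simp only: x_def[symmetric] H_def)
      thus ?thesis
        using gradient_step_contraction[OF H a, of "x k - xs"] by (simp only: V_def L \<mu>)
    qed
    moreover have "0 \<le> 1 - \<mu> / L" using pos by simp
    ultimately have V: "V k \<le> (1 - \<mu> / L) ^ k * V 0" for k
    proof (induction k)
      case (Suc k)
      have "V (Suc k) \<le> (1 - \<mu> / L) * V k" by (rule Suc.prems)
      also have "\<dots> \<le> (1 - \<mu> / L) * ((1 - \<mu> / L) ^ k * V 0)"
        by (intro mult_left_mono Suc.IH Suc.prems)
      finally show ?case by (simp add: mult_ac)
    qed simp
    have "avg_quad n A b (x k) - avg_quad n A b xs \<le> (C * V 0) * (1 - \<mu> / L) ^ k" for k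
      using C(2)[of k] mult_left_mono[OF V[of k] C(1)] by (simp add: mult_ac)
    moreover have "0 \<le> C * V 0" using C(1) H by (simp add: V_def sym_psd_def)
    ultimately show ?thesis
      using geometric_decay_iteration_count[of "\<mu> / L" "C * V 0"
          "\<lambda>k. avg_quad n A b (x k) - avg_quad n A b xs"] pos by simp
  qed
  thus ?thesis by (simp only: x_def L_def \<mu>_def)
qed

end
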